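(* Let $X_G$ be the shift space generated by a two-dimensional graph $G=(H,V)$, where neither adjacency matrix $H$ nor $V$ has a zero row or a zero column. If $(HV)_{ij}\neq 0 \Rightarrow (VH)_{ij}\neq 0$ for all indices $i,j$, or $(VH)_{ij}\neq 0 \Rightarrow (HV)_{ij}\neq 0$ for all indices $i,j$, then $X_G$ possesses periodic points of arbitrarily large periods, i.e. for every $R\in\mathbb{N}$ there exist a point $x\in X_G$ and a period $u$ of $x$ with $\|u\|\ge R$.
   Context: A two-dimensional graph is a pair $G=(H,V)$ of directed graphs (at most one edge for each ordered pair of vertices, loops allowed) on a common finite nonempty vertex set $\mathcal{V}$; $H$ and $V$ also denote their $0$-$1$ adjacency matrices indexed by $\mathcal{V}$. The shift space generated by $G$ is $$X_G=\{x\in\mathcal{V}^{\mathbb{Z}^2}: H_{x(i,j),x(i+1,j)}=1 \text{ and } V_{x(i,j),x(i,j+1)}=1 \text{ for all } (i,j)\in\mathbb{Z}^2\}.$$ A point $x$ is periodic if there is $u\in\mathbb{Z}^2\setminus\{0\}$ with $x(v+u)=x(v)$ for all $v\in\mathbb{Z}^2$; any such $u$ is called a period of $x$ (periods are not required to be minimal). $\|\cdot\|$ is the Euclidean norm. *)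

theory Defs
  imports "HOL-Analysis.Analysis"
begin

text \<open>
  The common finite nonempty vertex set is the universe of a type of class \<open>finite\<close>. A directed
  graph with at most one edge for each ordered pair of vertices, loops allowed, is its edge relation.
\<close>

type_synonym 'v graph2d = "'v rel \<times> 'v rel"

type_synonym 'v config = "int \<times> int \<Rightarrow> 'v"

definition adj_matrix :: "'v::finite rel \<Rightarrow> nat ^ 'v ^ 'v" where
  "adj_matrix E = (\<chi> a b. if (a, b) \<in> E then 1 else 0)"

definition shift_space :: "'v::finite graph2d \<Rightarrow> 'v config set" where
  "shift_space G = {x. \<forall>i j.
     adj_matrix (fst G) $ x (i, j) $ x (i + 1, j) = 1 \<and>
     adj_matrix (snd G) $ x (i, j) $ x (i, j + 1) = 1}"

definition no_zero_row_or_column :: "nat ^ 'v ^ 'v \<Rightarrow> bool" where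
  "no_zero_row_or_column A \<longleftrightarrow> (\<forall>i. row i A \<noteq> 0) \<and> (\<forall>j. column j A \<noteq> 0)"

definition is_period :: "'v config \<Rightarrow> int \<times> int \<Rightarrow> bool" where
  "is_period x u \<longleftrightarrow> u \<noteq> 0 \<and> (\<forall>v. x (v + u) = x v)"

text \<open>The library norm on \<open>real \<times> real\<close> is the Euclidean one.\<close>

definition norm_Z2 :: "int \<times> int \<Rightarrow> real" where
  "norm_Z2 u = norm (real_of_int (fst u), real_of_int (snd u))"

end

theory Submission
  imports Defs
begin

text \<open>
  Why the theorem holds. A multiple of a period is a period, so a single periodic point of \<open>X_G\<close>
  suffices; it is built with a diagonal period \<open>(n, n)\<close>.

  Suppose every \<open>HV\<close>-path can be replaced by a \<open>VH\<close>-path with the same ends. A point of \<open>X_G\<close> is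
  read along its diagonals \<open>D\<^sub>k(i) = x(i, i + k)\<close>. Going from \<open>D\<^sub>k(i)\<close> to \<open>D\<^sub>k(i + 1)\<close> one step to
  the right and one step up shows that \<open>D\<^sub>k\<close> is a bi-infinite path for the relation \<open>HV\<close>.
  Conversely, let any bi-infinite \<open>HV\<close>-path be given. Fill in, between each \<open>D\<^sub>k(i)\<close> and
  \<open>D\<^sub>k(i + 1)\<close>, the middle vertex of a corresponding \<open>VH\<close>-path. These middle vertices serve as
  the next diagonal \<open>D\<^sub>k\<^sub>+\<^sub>1\<close>: consecutive ones are joined by an \<open>H\<close>-edge into \<open>D\<^sub>k(i + 1)\<close> and a
  \<open>V\<close>-edge out of it, so they form an \<open>HV\<close>-path again and the filling can be repeated.

  If the middle vertex is chosen as a function of the two ends, filling commutes with translation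
  along the diagonal, hence maps the \<open>n\<close>-periodic \<open>HV\<close>-paths to themselves. For some \<open>n\<close> this set
  is nonempty, since \<open>HV\<close> has no zero row and the vertex set is finite. It is also finite, so the
  filling map has a cycle on it. Running round the cycle in both directions gives
  diagonals for all \<open>k \<in> \<int>\<close> and thereby a point with period \<open>(n, n)\<close>. The other hypothesis is
  the same one after exchanging the two coordinates.
\<close>

text \<open>
  Both finiteness steps of the proof have this form: a self-map of a finite set has a cycle,
  and a cycle can be followed backwards as well as forwards. Periodicity with period \<open>n\<close> is written
  \<open>D (k mod n) = D k\<close>, which also says that \<open>D\<close> is determined by finitely many values.
\<close>

lemma bi_infinite_periodic_orbit:
  fixes f :: "'a \<Rightarrow> 'a"
  assumes "finite A" and "A \<noteq> {}" and maps: "\<And>a. a \<in> A \<Longrightarrow> f a \<in> A"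
  obtains D :: "int \<Rightarrow> 'a" and n :: int
  where "n > 0" and "\<And>k. D (k mod n) = D k" and "\<And>k. D k \<in> A" and "\<And>k. D (k + 1) = f (D k)"
proof -
  obtain a where a: "a \<in> A" using \<open>A \<noteq> {}\<close> by blast
  have in_A: "(f ^^ k) a \<in> A" for k
    by (induction k) (auto simp: a maps)
  have "range (\<lambda>k. (f ^^ k) a) \<subseteq> A" using in_A by blast
  then have "\<not> inj (\<lambda>k. (f ^^ k) a)"
    using \<open>finite A\<close> finite_subset range_inj_infinite by blast
  then obtain p q where "p < q" and pq: "(f ^^ p) a = (f ^^ q) a"
    unfolding inj_def by (metis nat_neq_iff)
  define w where "w = (f ^^ p) a"
  define n where "n = int (q - p)"
  have "n > 0" using \<open>p < q\<close> by (simp add: n_def)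
  have cycle: "(f ^^ nat n) w = w"
    using \<open>p < q\<close> pq funpow_add[of "q - p" p f] by (simp add: w_def n_def nat_diff_distrib)
  define D where "D k = (f ^^ nat (k mod n)) w" for k
  have "D (k + 1) = f (D k)" for k
  proof (cases "k mod n + 1 = n")
    case True
    then have "nat n = Suc (nat (k mod n))" by (metis \<open>n > 0\<close> Suc_nat_eq_nat_zadd1 add.commute pos_mod_sign)
    then have "f (D k) = w" using cycle by (simp add: D_def)
    moreover have "(k + 1) mod n = 0" using True by (metis mod_add_left_eq mod_self)
    ultimately show ?thesis by (simp add: D_def)
  next
    case False
    then have "k mod n + 1 < n" using pos_mod_bound[OF \<open>n > 0\<close>, of k] by linarith
    then have "(k + 1) mod n = k mod n + 1"
      by (metis \<open>n > 0\<close> mod_add_left_eq mod_pos_pos_trivial pos_mod_sign add_nonneg_nonneg zero_le_one)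
    then have "nat ((k + 1) mod n) = Suc (nat (k mod n))"
      using \<open>n > 0\<close> by (simp add: nat_add_distrib)
    then show ?thesis by (simp add: D_def)
  qed
  moreover have "D k \<in> A" for k
    using in_A[of "nat (k mod n) + p"] by (simp add: D_def w_def funpow_add)
  moreover have "D (k mod n) = D k" for k by (simp add: D_def)
  ultimately show ?thesis using \<open>n > 0\<close> by (intro that[of n D])
qed

lemma finite_periodic_functions:
  fixes n :: int
  assumes "n > 0"
  shows "finite {w :: int \<Rightarrow> 'a::finite. \<forall>i. w (i mod n) = w i}" (is "finite ?P")
proof (rule finite_subset)
  show "?P \<subseteq> (\<lambda>g i. g (i mod n)) ` ({0..<n} \<rightarrow>\<^sub>E UNIV)"
  proof
    fix w :: "int \<Rightarrow> 'a" assume "w \<in> ?P"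
    then have "w = (\<lambda>i. restrict w {0..<n} (i mod n))" using assms by auto
    then show "w \<in> (\<lambda>g i. g (i mod n)) ` ({0..<n} \<rightarrow>\<^sub>E UNIV)"
      by (intro image_eqI[of w _ "restrict w {0..<n}"] restrict_PiE_iff[THEN iffD2] ballI UNIV_I)
  qed
  show "finite ((\<lambda>g i. g (i mod n)) ` ({0..<n} \<rightarrow>\<^sub>E (UNIV :: 'a set)))"
    by (intro finite_imageI finite_PiE) auto
qed

text \<open>
  The core of the argument, in terms of edge relations: the filling map sends a diagonal to the
  adjacent one above it, and a cycle of this map on periodic \<open>h O v\<close>-paths is a periodic point.
\<close>

lemma diagonally_periodic_tiling:
  fixes h v :: "'a::finite rel"
  assumes serial_h: "\<And>a. \<exists>b. (a, b) \<in> h" and serial_v: "\<And>a. \<exists>b. (a, b) \<in> v"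
    and swap: "h O v \<subseteq> v O h"
  obtains x :: "int \<Rightarrow> int \<Rightarrow> 'a" and n :: int
  where "n > 0" and "\<And>i j. (x i j, x (i + 1) j) \<in> h" and "\<And>i j. (x i j, x i (j + 1)) \<in> v"
    and "\<And>i j k. x (i + n * k) (j + n * k) = x i j"
proof -
  have "\<exists>c. (a, c) \<in> h O v" for a using serial_h serial_v by blast
  then obtain g where g: "\<And>a. (a, g a) \<in> h O v" by metis
  obtain w0 :: "int \<Rightarrow> 'a" and n where n: "n > 0"
    and w0: "\<And>i. w0 (i mod n) = w0 i" "\<And>i. w0 (i + 1) = g (w0 i)"
    by (rule bi_infinite_periodic_orbit[of UNIV g]) auto
  define P where "P = {w. (\<forall>i. w (i mod n) = w i) \<and> (\<forall>i. (w i, w (i + 1)) \<in> h O v)}"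
  have "finite P"
    by (rule finite_subset[OF _ finite_periodic_functions[OF n]]) (auto simp: P_def)
  have "w0 \<in> P" using w0 g by (simp add: P_def)
  then have "P \<noteq> {}" by blast
  \<comment> \<open>The middle vertex depends on its two neighbours only; this keeps the period \<open>n\<close>.\<close>
  have "\<exists>b. (a, c) \<in> h O v \<longrightarrow> (a, b) \<in> v \<and> (b, c) \<in> h" for a c
    using subsetD[OF swap, of "(a, c)"] by blast
  then obtain mid where mid: "\<And>a c. (a, c) \<in> h O v \<Longrightarrow> (a, mid a c) \<in> v \<and> (mid a c, c) \<in> h"
    by metis
  define fill where "fill w = (\<lambda>i :: int. mid (w i) (w (i + 1)))" for w
  have fill_v: "(w i, fill w i) \<in> v" and fill_h: "(fill w i, w (i + 1)) \<in> h" if "w \<in> P" for w i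
    using that mid by (auto simp: P_def fill_def)
  have fill_P: "fill w \<in> P" if "w \<in> P" for w
  proof -
    have per: "w (i mod n) = w i" for i using that by (auto simp: P_def)
    have "fill w (i mod n) = fill w i" for i
      using per[of "i mod n + 1"] per[of "i + 1"] per[of i] by (simp add: fill_def mod_simps)
    moreover have "(fill w i, fill w (i + 1)) \<in> h O v" for i
      using fill_h[OF that] fill_v[OF that] by blast
    ultimately show ?thesis by (simp add: P_def)
  qed
  obtain D :: "int \<Rightarrow> int \<Rightarrow> 'a" where D: "\<And>k. D k \<in> P" "\<And>k. D (k + 1) = fill (D k)"
    by (rule bi_infinite_periodic_orbit[of P fill, OF \<open>finite P\<close> \<open>P \<noteq> {}\<close> fill_P]) metis+
  define x where "x i j = D (j - i) i" for i j
  have "(x i j, x (i + 1) j) \<in> h" for i j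
    using fill_h[OF D(1), of "j - i - 1" i] D(2)[of "j - i - 1"] by (simp add: x_def algebra_simps)
  moreover have "(x i j, x i (j + 1)) \<in> v" for i j
    using fill_v[OF D(1), of "j - i" i] D(2)[of "j - i"] by (simp add: x_def algebra_simps)
  moreover have "x (i + n * k) (j + n * k) = x i j" for i j k
  proof -
    have "D l (i mod n) = D l i" for l i using D(1)[of l] by (auto simp: P_def)
    from this[of "j - i" i] this[of "j - i" "i + n * k"] show ?thesis by (simp add: x_def)
  qed
  ultimately show ?thesis using n by (intro that[of n x])
qed

lemma adj_matrix_mult_nonzero_iff:
  "(adj_matrix E ** adj_matrix F) $ i $ j \<noteq> 0 \<longleftrightarrow> (i, j) \<in> E O F"
  by (auto simp: matrix_matrix_mult_def adj_matrix_def relcomp_unfold)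

lemma no_zero_row_imp_serial:
  assumes "no_zero_row_or_column (adj_matrix E)"
  shows "\<exists>b. (a, b) \<in> E"
proof -
  have "row a (adj_matrix E) \<noteq> 0" using assms by (auto simp: no_zero_row_or_column_def)
  then show ?thesis by (auto simp: row_def adj_matrix_def vec_eq_iff split: if_splits)
qed

lemma shift_space_iff:
  "x \<in> shift_space G \<longleftrightarrow>
     (\<forall>i j. (x (i, j), x (i + 1, j)) \<in> fst G \<and> (x (i, j), x (i, j + 1)) \<in> snd G)"
  unfolding shift_space_def adj_matrix_def by auto

text \<open>
  Translation by \<open>(n, n)\<close> is unaffected by exchanging the coordinates, so one period serves for
  both alternatives of the hypothesis.
\<close>

lemma diagonally_periodic_point:
  fixes G :: "'v::finite graph2d"
  assumes serial: "\<And>a. \<exists>b. (a, b) \<in> fst G" "\<And>a. \<exists>b. (a, b) \<in> snd G"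
    and "fst G O snd G \<subseteq> snd G O fst G \<or> snd G O fst G \<subseteq> fst G O snd G"
  obtains x :: "'v config" and n :: int
  where "x \<in> shift_space G" and "n > 0"
    and "\<And>i j k. x (i + n * k, j + n * k) = x (i, j)"
  using assms(3)
proof
  assume "fst G O snd G \<subseteq> snd G O fst G"
  from diagonally_periodic_tiling[OF serial this] obtain y :: "int \<Rightarrow> int \<Rightarrow> 'v" and n :: int where "n > 0"
    and "\<And>i j. (y i j, y (i + 1) j) \<in> fst G" "\<And>i j. (y i j, y i (j + 1)) \<in> snd G"
    and "\<And>i j k. y (i + n * k) (j + n * k) = y i j" by metis
  then show ?thesis
    by (intro that[of "\<lambda>(i, j). y i j" n]) (simp_all add: shift_space_iff)
next
  assume "snd G O fst G \<subseteq> fst G O snd G"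
  from diagonally_periodic_tiling[OF serial(2,1) this] obtain y :: "int \<Rightarrow> int \<Rightarrow> 'v" and n :: int where "n > 0"
    and "\<And>i j. (y i j, y (i + 1) j) \<in> snd G" "\<And>i j. (y i j, y i (j + 1)) \<in> fst G"
    and "\<And>i j k. y (i + n * k) (j + n * k) = y i j" by metis
  then show ?thesis
    by (intro that[of "\<lambda>(i, j). y j i" n]) (simp_all add: shift_space_iff)
qed

theorem corollary7:
  fixes G :: "'v::finite graph2d" and H V :: "nat ^ 'v ^ 'v"
  assumes H: "H = adj_matrix (fst G)" and V: "V = adj_matrix (snd G)"
    and "no_zero_row_or_column H" and "no_zero_row_or_column V"
    and "(\<forall>i j. (H ** V) $ i $ j \<noteq> 0 \<longrightarrow> (V ** H) $ i $ j \<noteq> 0) \<or>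
         (\<forall>i j. (V ** H) $ i $ j \<noteq> 0 \<longrightarrow> (H ** V) $ i $ j \<noteq> 0)"
  shows "\<forall>R::nat. \<exists>x \<in> shift_space G. \<exists>u. is_period x u \<and> norm_Z2 u \<ge> real R"
proof
  fix R :: nat
  have "\<And>a. \<exists>b. (a, b) \<in> fst G" "\<And>a. \<exists>b. (a, b) \<in> snd G"
    using assms(3,4) by (auto simp: H V intro: no_zero_row_imp_serial)
  moreover have "fst G O snd G \<subseteq> snd G O fst G \<or> snd G O fst G \<subseteq> fst G O snd G"
    using assms(5) unfolding H V adj_matrix_mult_nonzero_iff by (simp add: subset_iff)
  ultimately obtain x :: "'v config" and n :: int where x: "x \<in> shift_space G" and n: "n > 0"
    and per: "\<And>i j k. x (i + n * k, j + n * k) = x (i, j)"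
    by (rule diagonally_periodic_point) metis
  \<comment> \<open>\<open>R + 1\<close> instead of \<open>R\<close>, because a period must be nonzero even for \<open>R = 0\<close>.\<close>
  define u where "u = (n * (int R + 1), n * (int R + 1))"
  have "is_period x u"
    using n per[of _ "int R + 1"] by (auto simp: is_period_def u_def zero_prod_def)
  moreover have "norm_Z2 u \<ge> real R"
  proof -
    have "int R \<le> 1 * (int R + 1)" by simp
    also have "\<dots> \<le> n * (int R + 1)" using n by (intro mult_right_mono) auto
    finally have "real R \<le> real_of_int (n * (int R + 1))" by (metis of_int_le_iff of_int_of_nat_eq)
    also have "\<dots> \<le> norm (real_of_int (fst u))" by (simp add: u_def)
    also have "\<dots> \<le> norm_Z2 u" unfolding norm_Z2_def by (rule norm_fst_le)
    finally show ?thesis .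
  qed
  ultimately show "\<exists>x \<in> shift_space G. \<exists>u. is_period x u \<and> norm_Z2 u \<ge> real R"
    using x by blast
qed

end
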